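(* Let $A=[a_{ij}]$ be an $n\times n$ pairwise reciprocal matrix. The Lagrange expression for the weighted least squares problem is $$y=\left(\sum_{i=1}^n\sum_{j=1}^n (w_i-a_{ij}w_j)^2\right)+\dot\lambda\left(\left(\sum_{i=1}^n w_i\right)-1\right),$$ where $\dot\lambda=2\lambda$ is a Lagrange multiplier. Setting the partial derivatives of $y$ with respect to $w_k$ ($k=1,\ldots,n$) and the multiplier equal to zero gives $$\left((n-1)+\sum_{i\neq k}a_{ik}^2\right)w_k+\left(\sum_{i\neq k}(-a_{ik}-a_{ki})w_i\right)+\lambda=0,\qquad k=1,\ldots,n,$$ $$\sum_{i=1}^n w_i=1.$$ The matrix expression of this system of linear equations is $$\ddot G\,\ddot w^T=\ddot q^T,$$ where $\ddot q=(\mathbf 0,1)$ with $\mathbf 0=(0,\ldots,0)$ of length $n$, and $\ddot w=(w,\lambda)=(w_1,\ldots,w_n,\lambda)$ is the vector of solution weights and Lagrange multiplier. The matrix $\ddot G$ is also a symmetric Gram matrix; it is the $2\times 2$ partition matrix based on $\bar G$ given by $$\ddot G=\begin{bmatrix}\bar G & e^T\\ e & 0\end{bmatrix}.$$ The solution of the system (the Lagrangian Inverse Gram Matrix solution) is $$\ddot w=(w,\lambda)=\ddot q\,\ddot G^{-1}.$$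
   Context: A pairwise reciprocal matrix (PRM) of size $n$ is a real $n\times n$ matrix $A=[a_{ij}]$ with $0<a_{ij}=a_{ji}^{-1}$ for all $i,j\in\{1,\ldots,n\}$ (in particular $a_{ii}=1$). The weighted least squares (WLS) problem for $A$ is to minimize $\sum_{i=1}^n\sum_{j=1}^n(w_i-a_{ij}w_j)^2$ subject to $\sum_{i=1}^n w_i=1$ and $w_i>0$ for $i=1,\ldots,n$; the Lagrange expression involves only the equality constraint. $e=(1,\ldots,1)$ denotes the row vector of ones of length $n$. $\bar G=[\bar g_{ij}]$ is the $n\times n$ matrix with $\bar g_{ii}=(n-1)+\sum_{k\neq i}a_{ki}^2$ and $\bar g_{ij}=-a_{ij}-a_{ji}$ for $i\neq j$. The term Gram matrix is used for a (symmetric) matrix of the form $D^TD$, where $D$ is a real matrix; for example $\bar G=\bar D^T\bar D$, where $\bar D$ is the $n(n-1)\times n$ matrix having, for each pair $i<j$, one row with entry $1$ in column $i$ and $-a_{ij}$ in column $j$, and one row with entry $-a_{ji}$ in column $i$ and $1$ in column $j$, all other entries being $0$.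
   Formalization: The claim that G̈ is a Gram matrix DᵀD (D real) is false for all n ≥ 1, since its last diagonal entry is 0 while its last row contains ones; it is replaced by: G̈ is symmetric and its block Ḡ is a Gram matrix. The size n is taken to be at least 1. *)

theory Defs
  imports Complex_Main "Jordan_Normal_Form.Matrix"
begin

(* Rows, columns and vector entries are indexed by 0, ..., n - 1. *)

definition pairwise_reciprocal :: "nat \<Rightarrow> real mat \<Rightarrow> bool" where
  "pairwise_reciprocal n A \<longleftrightarrow>
     A \<in> carrier_mat n n \<and>
     (\<forall>i<n. \<forall>j<n. 0 < A $$ (i, j) \<and> A $$ (i, j) = inverse (A $$ (j, i)))"

definition wls_objective :: "nat \<Rightarrow> real mat \<Rightarrow> real vec \<Rightarrow> real" where
  "wls_objective n A w = (\<Sum>i<n. \<Sum>j<n. (w $ i - A $$ (i, j) * w $ j)\<^sup>2)"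

definition wls_lagrangian :: "nat \<Rightarrow> real mat \<Rightarrow> real vec \<Rightarrow> real \<Rightarrow> real" where
  "wls_lagrangian n A w \<mu> = wls_objective n A w + \<mu> * ((\<Sum>i<n. w $ i) - 1)"

definition lagrange_system :: "nat \<Rightarrow> real mat \<Rightarrow> real vec \<Rightarrow> real \<Rightarrow> bool" where
  "lagrange_system n A w l \<longleftrightarrow>
     (\<forall>k<n. ((real n - 1) + (\<Sum>i\<in>{..<n} - {k}. (A $$ (i, k))\<^sup>2)) * w $ k
             + (\<Sum>i\<in>{..<n} - {k}. (- A $$ (i, k) - A $$ (k, i)) * w $ i) + l = 0) \<and>
     (\<Sum>i<n. w $ i) = 1"

definition G_bar :: "nat \<Rightarrow> real mat \<Rightarrow> real mat" where
  "G_bar n A = mat n n (\<lambda>(i, j).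
     if i = j then (real n - 1) + (\<Sum>k\<in>{..<n} - {i}. (A $$ (k, i))\<^sup>2)
     else - A $$ (i, j) - A $$ (j, i))"

definition ones_row :: "nat \<Rightarrow> real mat" where
  "ones_row n = mat 1 n (\<lambda>_. 1)"

definition G_ddot :: "nat \<Rightarrow> real mat \<Rightarrow> real mat" where
  "G_ddot n A =
     four_block_mat (G_bar n A) (transpose_mat (ones_row n)) (ones_row n) (0\<^sub>m 1 1)"

(* w_ddot and q_ddot are row vectors, represented as 1 x (n + 1) matrices. *)

definition w_ddot :: "real vec \<Rightarrow> real \<Rightarrow> real mat" where
  "w_ddot w l = mat_of_row (w @\<^sub>v vec 1 (\<lambda>_. l))"

definition q_ddot :: "nat \<Rightarrow> real mat" where
  "q_ddot n = mat_of_row (0\<^sub>v n @\<^sub>v vec 1 (\<lambda>_. 1))"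

definition gram_matrix :: "real mat \<Rightarrow> bool" where
  "gram_matrix G \<longleftrightarrow>
     (\<exists>m. \<exists>D \<in> carrier_mat m (dim_col G). G = transpose_mat D * D)"

(* The bordered matrix itself is never a Gram matrix in this sense: its last
   diagonal entry is 0, so the last column of D would vanish, although the
   last row of the bordered matrix contains ones.  Only the block G_bar is Gram. *)

lemma G_ddot_not_gram:
  assumes "0 < n"
  shows "\<not> gram_matrix (G_ddot n A)"
proof
  assume "gram_matrix (G_ddot n A)"
  then obtain m D where D: "D \<in> carrier_mat m (n + 1)"
    and G: "G_ddot n A = transpose_mat D * D"
    unfolding gram_matrix_def by (auto simp: G_ddot_def G_bar_def)
  have entry: "G_ddot n A $$ (i, j) = (\<Sum>r<m. D $$ (r, i) * D $$ (r, j))"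
    if "i \<le> n" "j \<le> n" for i j
    using that D by (auto simp: G scalar_prod_def lessThan_atLeast0)
  have "G_ddot n A $$ (n, n) = 0"
    by (simp add: G_ddot_def G_bar_def ones_row_def)
  then have "(\<Sum>r<m. (D $$ (r, n))\<^sup>2) = 0"
    using entry[of n n] by (simp add: power2_eq_square)
  then have "D $$ (r, n) = 0" if "r < m" for r
    using that by (simp add: sum_nonneg_eq_0_iff)
  then have "G_ddot n A $$ (n, 0) = 0"
    using entry[of n 0] by simp
  moreover have "G_ddot n A $$ (n, 0) = 1"
    using assms by (simp add: G_ddot_def G_bar_def ones_row_def)
  ultimately show False by simp
qed

end

theory Submission
  imports Defs "Jordan_Normal_Form.Determinant"
begin

text \<open>The residual \<open>w\<^sub>i - a\<^sub>i\<^sub>j w\<^sub>j\<close> is linear in \<open>w\<close>, and \<open>G_bar\<close> is the Gram matrix of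
  these \<open>n\<^sup>2\<close> linear forms (the forms with \<open>i = j\<close> vanish because \<open>a\<^sub>i\<^sub>i = 1\<close>). Hence half the gradient
  of the objective is \<open>G_bar w\<close> and the objective is the quadratic form of \<open>G_bar\<close>. If the bordered
  matrix annihilates \<open>(w, l)\<close>, then the entries of \<open>w\<close> sum to zero and
  \<open>w\<^sup>T G_bar w = - l \<Sum>\<^sub>i w\<^sub>i = 0\<close>, so \<open>w\<^sub>i = a\<^sub>i\<^sub>j w\<^sub>j\<close> for all \<open>i, j\<close>; by positivity of \<open>a\<^sub>i\<^sub>j\<close>
  all entries of \<open>w\<close> have the same sign, which forces \<open>w = 0\<close> and then \<open>l = 0\<close>.\<close>

section \<open>Residuals as linear forms and the matrix \<open>G_bar\<close>\<close>

text \<open>Subtracting two conditionals lets the case \<open>i = j = c\<close> give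
  \<open>1 - A $$ (i, i)\<close>, so sums can run over all ordered pairs without excluding the
  diagonal.\<close>

definition residual_coeff :: "real mat \<Rightarrow> nat \<Rightarrow> nat \<Rightarrow> nat \<Rightarrow> real" where
  "residual_coeff A i j c = (if c = i then 1 else 0) - (if c = j then A $$ (i, j) else 0)"

lemma pairwise_reciprocal_diag:
  assumes "pairwise_reciprocal n A" "i < n"
  shows "A $$ (i, i) = 1"
proof -
  have "0 < A $$ (i, i)" "A $$ (i, i) = inverse (A $$ (i, i))"
    using assms unfolding pairwise_reciprocal_def by blast+
  then have "A $$ (i, i) * A $$ (i, i) = 1"
    by (metis less_irrefl right_inverse)
  with \<open>0 < A $$ (i, i)\<close> show ?thesis
    by (simp add: square_eq_1_iff)
qed

lemma sum_residual_coeff: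
  assumes "i < n" "j < n"
  shows "(\<Sum>c<n. residual_coeff A i j c * f c) = f i - A $$ (i, j) * f j"
proof -
  have "residual_coeff A i j c * f c
      = (if c = i then f c else 0) - (if c = j then A $$ (i, j) * f c else 0)" for c
    by (simp add: residual_coeff_def algebra_simps)
  then show ?thesis
    using assms by (simp add: sum_subtractf)
qed

text \<open>Expanding the product leaves \<open>n\<close> on the diagonal, two cross terms, and the
  column of squares. For \<open>c = d\<close> the unit diagonal of \<open>A\<close> turns
  \<open>n - 2 + 1\<close> into the \<open>n - 1\<close> of \<open>G_bar\<close>.\<close>

lemma G_bar_eq_sum_residual_coeff:
  assumes "\<And>i. i < n \<Longrightarrow> A $$ (i, i) = 1" and "c < n" "d < n"
  shows "G_bar n A $$ (c, d)
    = (\<Sum>i<n. \<Sum>j<n. residual_coeff A i j c * residual_coeff A i j d)"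
proof -
  \<comment> \<open>Each test involves at most one summation index, so the sums over
    \<open>j\<close> and then \<open>i\<close> collapse as sums over a single point.\<close>
  have "residual_coeff A i j c * residual_coeff A i j d
      = (if i = c then if c = d then 1 else 0 else 0)
        - (if i = c then if j = d then A $$ (c, d) else 0 else 0)
        - (if i = d then if j = c then A $$ (d, c) else 0 else 0)
        + (if j = c then if c = d then (A $$ (i, c))\<^sup>2 else 0 else 0)" for i j
    by (auto simp: residual_coeff_def power2_eq_square algebra_simps)
  then have "(\<Sum>j<n. residual_coeff A i j c * residual_coeff A i j d)
      = (if i = c then if c = d then real n else 0 else 0)
        - (if i = c then A $$ (c, d) else 0)
        - (if i = d then A $$ (d, c) else 0)
        + (if c = d then (A $$ (i, c))\<^sup>2 else 0)" for i
    using assms(2,3) by (simp add: sum_subtractf sum.distrib)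
  then have "(\<Sum>i<n. \<Sum>j<n. residual_coeff A i j c * residual_coeff A i j d)
      = (if c = d then real n else 0) - A $$ (c, d) - A $$ (d, c)
        + (if c = d then \<Sum>i<n. (A $$ (i, c))\<^sup>2 else 0)"
    using assms(2,3) by (simp add: sum_subtractf sum.distrib)
  moreover have "(\<Sum>i<n. (A $$ (i, c))\<^sup>2) = 1 + (\<Sum>i\<in>{..<n} - {c}. (A $$ (i, c))\<^sup>2)"
    using assms by (subst sum.remove[of _ c]) auto
  ultimately show ?thesis
    using assms by (cases "c = d") (auto simp: G_bar_def)
qed

text \<open>Exchanging the sum over \<open>c\<close> with the sums over pairs rebuilds the
  residuals. The right-hand side is half the \<open>k\<close>-th partial derivative of the objective
  at \<open>f\<close>.\<close>

lemma G_bar_row_sum: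
  assumes "\<And>i. i < n \<Longrightarrow> A $$ (i, i) = 1" and "k < n"
  shows "(\<Sum>c<n. G_bar n A $$ (k, c) * f c)
    = (\<Sum>i<n. \<Sum>j<n. residual_coeff A i j k * (f i - A $$ (i, j) * f j))"
proof -
  have "(\<Sum>c<n. G_bar n A $$ (k, c) * f c)
      = (\<Sum>c<n. \<Sum>i<n. \<Sum>j<n. residual_coeff A i j k * (residual_coeff A i j c * f c))"
    by (intro sum.cong refl)
      (simp add: G_bar_eq_sum_residual_coeff[OF assms(1) assms(2)] sum_distrib_right mult.assoc)
  also have "\<dots> = (\<Sum>i<n. \<Sum>j<n. \<Sum>c<n. residual_coeff A i j k * (residual_coeff A i j c * f c))"
    by (subst sum.swap) (intro sum.cong refl sum.swap)
  also have "\<dots> = (\<Sum>i<n. \<Sum>j<n. residual_coeff A i j k * (f i - A $$ (i, j) * f j))"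
    by (intro sum.cong refl) (simp add: sum_residual_coeff flip: sum_distrib_left)
  finally show ?thesis .
qed

text \<open>Summing over \<open>k\<close> as well turns the remaining coefficient into a second copy
  of the residual, hence a square.\<close>

lemma G_bar_quadratic_form:
  assumes "\<And>i. i < n \<Longrightarrow> A $$ (i, i) = 1"
  shows "(\<Sum>k<n. w $ k * (\<Sum>c<n. G_bar n A $$ (k, c) * w $ c)) = wls_objective n A w"
proof -
  have "(\<Sum>k<n. w $ k * (\<Sum>c<n. G_bar n A $$ (k, c) * w $ c))
      = (\<Sum>k<n. \<Sum>i<n. \<Sum>j<n. residual_coeff A i j k * w $ k * (w $ i - A $$ (i, j) * w $ j))"
    by (intro sum.cong refl, subst G_bar_row_sum[OF assms])
      (simp_all add: sum_distrib_left mult_ac)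
  also have "\<dots> = (\<Sum>i<n. \<Sum>j<n. \<Sum>k<n. residual_coeff A i j k * w $ k * (w $ i - A $$ (i, j) * w $ j))"
    by (subst sum.swap) (intro sum.cong refl sum.swap)
  also have "\<dots> = wls_objective n A w"
    unfolding wls_objective_def
    by (intro sum.cong refl)
      (simp add: sum_residual_coeff power2_eq_square flip: sum_distrib_right)
  finally show ?thesis .
qed

section \<open>Stationarity of the Lagrangian\<close>

lemma wls_lagrangian_partial_derivative:
  assumes "\<And>i. i < n \<Longrightarrow> A $$ (i, i) = 1" and w: "w \<in> carrier_vec n" and k: "k < n"
  shows "((\<lambda>t. wls_lagrangian n A (w |\<^sub>v k \<mapsto> t) (2 * l)) has_real_derivative
    2 * ((\<Sum>c<n. G_bar n A $$ (k, c) * w $ c) + l)) (at (w $ k))"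
proof -
  \<comment> \<open>Along coordinate \<open>k\<close> every residual is affine in \<open>t\<close>,
    with slope its coefficient at \<open>k\<close>.\<close>
  have res: "(w |\<^sub>v k \<mapsto> t) $ i - A $$ (i, j) * (w |\<^sub>v k \<mapsto> t) $ j
      = (w $ i - A $$ (i, j) * w $ j) + residual_coeff A i j k * (t - w $ k)"
    if "i < n" "j < n" for i j t
    using that w k by (auto simp: residual_coeff_def algebra_simps)
  have upd: "(\<Sum>i<n. (w |\<^sub>v k \<mapsto> t) $ i) = (\<Sum>i<n. w $ i) + (t - w $ k)" for t
  proof -
    have "(\<Sum>i<n. (w |\<^sub>v k \<mapsto> t) $ i) = (\<Sum>i<n. w $ i + (if i = k then t - w $ k else 0))"
      using w by (intro sum.cong) auto
    also have "\<dots> = (\<Sum>i<n. w $ i) + (t - w $ k)"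
      using k by (simp add: sum.distrib)
    finally show ?thesis .
  qed
  have L: "(\<lambda>t. wls_lagrangian n A (w |\<^sub>v k \<mapsto> t) (2 * l))
      = (\<lambda>t. (\<Sum>i<n. \<Sum>j<n.
                ((w $ i - A $$ (i, j) * w $ j) + residual_coeff A i j k * (t - w $ k))\<^sup>2)
            + 2 * l * ((\<Sum>i<n. w $ i) + (t - w $ k) - 1))"
    by (simp add: wls_lagrangian_def wls_objective_def upd res)
  have "((\<lambda>t. \<Sum>i<n. \<Sum>j<n.
            ((w $ i - A $$ (i, j) * w $ j) + residual_coeff A i j k * (t - w $ k))\<^sup>2)
      has_real_derivative
        (\<Sum>i<n. \<Sum>j<n. 2 * (residual_coeff A i j k * (w $ i - A $$ (i, j) * w $ j)))) (at (w $ k))"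
    by (intro DERIV_sum) (auto intro!: derivative_eq_intros)
  moreover have "((\<lambda>t. 2 * l * ((\<Sum>i<n. w $ i) + (t - w $ k) - 1)) has_real_derivative 2 * l) (at (w $ k))"
    by (auto intro!: derivative_eq_intros)
  ultimately show ?thesis
    unfolding L
    by (rule DERIV_add[THEN DERIV_cong])
      (simp add: G_bar_row_sum[OF assms(1) k] distrib_left sum_distrib_left)
qed

lemma lagrange_system_iff:
  "lagrange_system n A w l \<longleftrightarrow>
    (\<forall>k<n. (\<Sum>c<n. G_bar n A $$ (k, c) * w $ c) + l = 0) \<and> (\<Sum>i<n. w $ i) = 1"
proof -
  have "(\<Sum>c<n. G_bar n A $$ (k, c) * w $ c)
      = ((real n - 1) + (\<Sum>i\<in>{..<n} - {k}. (A $$ (i, k))\<^sup>2)) * w $ k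
        + (\<Sum>i\<in>{..<n} - {k}. (- A $$ (i, k) - A $$ (k, i)) * w $ i)" if "k < n" for k
    using that by (subst sum.remove[of _ k]) (auto simp: G_bar_def intro!: sum.cong)
  then show ?thesis
    by (simp add: lagrange_system_def)
qed

section \<open>Gram factorization of \<open>G_bar\<close>\<close>

lemma G_bar_gram:
  assumes "\<And>i. i < n \<Longrightarrow> A $$ (i, i) = 1"
  shows "gram_matrix (G_bar n A)"
proof -
  \<comment> \<open>One row per ordered pair \<open>(i, j)\<close>, numbered
    \<open>i * n + j\<close>; the pairs with \<open>i = j\<close> give zero rows, which do not
    change the product.\<close>
  define D where "D = mat (n * n) n (\<lambda>(r, c). residual_coeff A (r div n) (r mod n) c)"
  have index_bound: "i * n + j < n * n" if "i < n" "j < n" for i j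
  proof -
    have "i * n + j < Suc i * n"
      using that by simp
    also have "\<dots> \<le> n * n"
      using that by (intro mult_right_mono) auto
    finally show ?thesis .
  qed
  have dims: "dim_row (G_bar n A) = n" "dim_col (G_bar n A) = n"
    by (simp_all add: G_bar_def)
  have "G_bar n A = transpose_mat D * D"
  proof (rule eq_matI)
    fix c d assume "c < dim_row (transpose_mat D * D)" "d < dim_col (transpose_mat D * D)"
    then have cd: "c < n" "d < n"
      by (simp_all add: D_def)
    have "(transpose_mat D * D) $$ (c, d)
        = (\<Sum>r<n * n. residual_coeff A (r div n) (r mod n) c * residual_coeff A (r div n) (r mod n) d)"
      using cd by (simp add: D_def scalar_prod_def lessThan_atLeast0)
    also have "\<dots> = (\<Sum>i<n. \<Sum>j<n. residual_coeff A i j c * residual_coeff A i j d)"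
      unfolding sum.cartesian_product
      by (rule sum.reindex_bij_witness[where i = "\<lambda>(i, j). i * n + j" and j = "\<lambda>r. (r div n, r mod n)"])
        (auto simp: less_mult_imp_div_less index_bound intro!: mod_less_divisor gr0I)
    finally show "G_bar n A $$ (c, d) = (transpose_mat D * D) $$ (c, d)"
      using G_bar_eq_sum_residual_coeff[OF assms cd] by simp
  qed (simp_all add: D_def dims)
  then show ?thesis
    unfolding gram_matrix_def dims by (intro exI[of _ "n * n"] bexI[of _ D]) (simp_all add: D_def)
qed

section \<open>The bordered matrix and the linear system\<close>

lemma G_ddot_carrier: "G_ddot n A \<in> carrier_mat (n + 1) (n + 1)"
  by (auto simp: G_ddot_def G_bar_def ones_row_def)

lemma G_ddot_symmetric: "transpose_mat (G_ddot n A) = G_ddot n A"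
  by (rule eq_matI) (auto simp: G_ddot_def G_bar_def ones_row_def)

text \<open>Blockwise multiplication: the border column adds the multiplier to each row of
  \<open>G_bar\<close>, and the border row produces the constraint.\<close>

lemma G_ddot_mult_vec:
  assumes "w \<in> carrier_vec n"
  shows "G_ddot n A *\<^sub>v (w @\<^sub>v vec 1 (\<lambda>_. l))
    = vec n (\<lambda>k. (\<Sum>c<n. G_bar n A $$ (k, c) * w $ c) + l) @\<^sub>v vec 1 (\<lambda>_. \<Sum>i<n. w $ i)"
proof -
  have "G_bar n A *\<^sub>v w = vec n (\<lambda>k. \<Sum>c<n. G_bar n A $$ (k, c) * w $ c)"
    using assms by (intro eq_vecI) (auto simp: G_bar_def scalar_prod_def lessThan_atLeast0)
  moreover have "transpose_mat (ones_row n) *\<^sub>v vec 1 (\<lambda>_. l) = vec n (\<lambda>_. l)"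
    by (intro eq_vecI) (auto simp: ones_row_def scalar_prod_def)
  moreover have "ones_row n *\<^sub>v w = vec 1 (\<lambda>_. \<Sum>i<n. w $ i)"
    using assms by (intro eq_vecI) (auto simp: ones_row_def scalar_prod_def lessThan_atLeast0)
  moreover have "vec n f + vec n g = vec n (\<lambda>k. f k + g k)" for f g :: "nat \<Rightarrow> real"
    by (intro eq_vecI) auto
  ultimately show ?thesis
    unfolding G_ddot_def
    using assms
    by (subst four_block_mat_mult_vec[of _ n n _ 1 _ 1])
      (auto simp: G_bar_def ones_row_def)
qed

lemma mat_of_row_eq_iff [simp]: "mat_of_row u = mat_of_row v \<longleftrightarrow> u = v"
  by (metis row_mat_of_row)

lemma mult_transpose_mat_of_row:
  fixes M :: "'a :: comm_semiring_0 mat"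
  assumes "M \<in> carrier_mat nr nc" "v \<in> carrier_vec nc"
  shows "M * transpose_mat (mat_of_row v) = transpose_mat (mat_of_row (M *\<^sub>v v))"
  using assms by (intro eq_matI) auto

lemma lagrange_system_iff_G_ddot:
  assumes w: "w \<in> carrier_vec n"
  shows "lagrange_system n A w l \<longleftrightarrow>
    G_ddot n A * transpose_mat (w_ddot w l) = transpose_mat (q_ddot n)"
proof -
  have c: "w @\<^sub>v vec 1 (\<lambda>_. l) \<in> carrier_vec (n + 1)"
    by (rule append_carrier_vec[OF w]) simp
  have "G_ddot n A * transpose_mat (w_ddot w l) = transpose_mat (q_ddot n) \<longleftrightarrow>
      vec n (\<lambda>k. (\<Sum>c<n. G_bar n A $$ (k, c) * w $ c) + l) = 0\<^sub>v n \<and>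
      vec 1 (\<lambda>_. \<Sum>i<n. w $ i) = vec 1 (\<lambda>_. 1)"
    unfolding w_ddot_def q_ddot_def mult_transpose_mat_of_row[OF G_ddot_carrier c]
      G_ddot_mult_vec[OF w] transpose_mat_eq mat_of_row_eq_iff
    by (rule append_vec_eq) auto
  also have "\<dots> \<longleftrightarrow> lagrange_system n A w l"
    unfolding lagrange_system_iff by (auto simp: vec_eq_iff)
  finally show ?thesis by simp
qed

section \<open>Nonsingularity of the bordered matrix\<close>

lemma wls_objective_eq_0:
  assumes "pairwise_reciprocal n A" and w: "w \<in> carrier_vec n"
    and obj: "wls_objective n A w = 0" and sum: "(\<Sum>i<n. w $ i) = 0"
  shows "w = 0\<^sub>v n"
proof -
  have eq: "w $ i = A $$ (i, j) * w $ j" if "i < n" "j < n" for i j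
  proof -
    have "(\<Sum>j<n. (w $ i - A $$ (i, j) * w $ j)\<^sup>2) = 0"
      using obj that(1) unfolding wls_objective_def
      by (subst (asm) sum_nonneg_eq_0_iff) (auto intro: sum_nonneg)
    then have "(w $ i - A $$ (i, j) * w $ j)\<^sup>2 = 0"
      using that(2) by (subst (asm) sum_nonneg_eq_0_iff) auto
    then show ?thesis by simp
  qed
  have "w $ j = 0" if j: "j < n" for j
  proof -
    \<comment> \<open>Since all residuals vanish, every entry is a multiple of \<open>w $ j\<close>;
      the total is \<open>w $ j\<close> times a positive column sum.\<close>
    have "(\<Sum>i<n. w $ i) = (\<Sum>i<n. A $$ (i, j)) * w $ j"
      unfolding sum_distrib_right using j by (intro sum.cong refl eq) auto
    moreover have "(\<Sum>i<n. A $$ (i, j)) > 0"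
    proof (rule sum_pos)
      show "0 < A $$ (i, j)" if "i \<in> {..<n}" for i
        using assms(1) that j unfolding pairwise_reciprocal_def by blast
    qed (use j in auto)
    ultimately show ?thesis
      using sum by simp
  qed
  then show ?thesis
    using w by auto
qed

text \<open>A singular matrix would annihilate a nonzero vector. For \<open>n = 0\<close> the
  bordered matrix is the zero matrix of size 1, so positivity of \<open>n\<close> matters.\<close>

lemma det_G_ddot_nonzero:
  assumes "0 < n" and A: "pairwise_reciprocal n A"
  shows "det (G_ddot n A) \<noteq> 0"
proof
  note diag = pairwise_reciprocal_diag[OF A]
  assume "det (G_ddot n A) = 0"
  then obtain v where v: "v \<in> carrier_vec (n + 1)" "v \<noteq> 0\<^sub>v (n + 1)"
    and Gv: "G_ddot n A *\<^sub>v v = 0\<^sub>v (n + 1)"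
    using det_0_iff_vec_prod_zero[OF G_ddot_carrier] by blast
  define w l where "w = vec_first v n" and "l = v $ n"
  have w: "w \<in> carrier_vec n"
    by (simp add: w_def)
  have v_eq: "v = w @\<^sub>v vec 1 (\<lambda>_. l)"
    using v(1) by (intro eq_vecI) (auto simp: w_def l_def vec_first_def less_Suc_eq)
  have zero: "0\<^sub>v (n + 1) = 0\<^sub>v n @\<^sub>v 0\<^sub>v 1"
    by (intro eq_vecI) auto
  have "vec n (\<lambda>k. (\<Sum>c<n. G_bar n A $$ (k, c) * w $ c) + l) = 0\<^sub>v n \<and>
      vec 1 (\<lambda>_. \<Sum>i<n. w $ i) = 0\<^sub>v 1"
    using Gv unfolding v_eq G_ddot_mult_vec[OF w] zero
    by (subst (asm) append_vec_eq) auto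
  then have sum: "(\<Sum>i<n. w $ i) = 0"
    and sys: "\<forall>k<n. (\<Sum>c<n. G_bar n A $$ (k, c) * w $ c) + l = 0"
    by (simp_all add: vec_eq_iff)
  have row: "(\<Sum>c<n. G_bar n A $$ (k, c) * w $ c) = - l" if "k < n" for k
    using sys that by (simp add: eq_neg_iff_add_eq_0)
  \<comment> \<open>Pairing the first \<open>n\<close> equations with \<open>w\<close> gives the
    objective on one side and \<open>- l\<close> times the vanishing entry sum on the other.\<close>
  have "wls_objective n A w = (\<Sum>k<n. w $ k * - l)"
    by (subst G_bar_quadratic_form[OF diag, symmetric]) (simp_all add: row)
  also have "\<dots> = 0"
    unfolding sum_distrib_right[symmetric] sum by simp
  finally have "w = 0\<^sub>v n"
    using wls_objective_eq_0[OF A w _ sum] by simp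
  \<comment> \<open>Row 0, which exists because \<open>0 < n\<close>, now reads
    \<open>0 = - l\<close>.\<close>
  moreover from this have "l = 0"
    using row[OF \<open>0 < n\<close>] by simp
  ultimately have "v = 0\<^sub>v (n + 1)"
    unfolding v_eq zero by (intro eq_vecI) auto
  with v(2) show False by simp
qed

theorem theorem4:
  fixes n :: nat and A :: "real mat"
  assumes "0 < n"
    and "pairwise_reciprocal n A"
  shows
    "(\<forall>w \<in> carrier_vec n. \<forall>l.
       (\<forall>k<n. ((\<lambda>t. wls_lagrangian n A (w |\<^sub>v k \<mapsto> t) (2 * l))
                  has_real_derivative 0) (at (w $ k))) \<and>
       ((\<lambda>\<mu>. wls_lagrangian n A w \<mu>) has_real_derivative 0) (at (2 * l))
       \<longleftrightarrow> lagrange_system n A w l)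
     \<and> (\<forall>w \<in> carrier_vec n. \<forall>l.
       lagrange_system n A w l
       \<longleftrightarrow> G_ddot n A * transpose_mat (w_ddot w l) = transpose_mat (q_ddot n))
     \<and> transpose_mat (G_ddot n A) = G_ddot n A
     \<and> gram_matrix (G_bar n A)
     \<and> (\<exists>H \<in> carrier_mat (n + 1) (n + 1).
       inverts_mat (G_ddot n A) H \<and> inverts_mat H (G_ddot n A) \<and>
       (\<forall>w \<in> carrier_vec n. \<forall>l.
          G_ddot n A * transpose_mat (w_ddot w l) = transpose_mat (q_ddot n)
          \<longleftrightarrow> w_ddot w l = q_ddot n * H))"
proof (intro conjI ballI allI)
  note diag = pairwise_reciprocal_diag[OF assms(2)]
  fix w :: "real vec" and l :: real assume w: "w \<in> carrier_vec n"
  \<comment> \<open>Uniqueness of derivatives turns vanishing of the partial derivative into a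
    linear equation.\<close>
  have "((\<lambda>t. wls_lagrangian n A (w |\<^sub>v k \<mapsto> t) (2 * l)) has_real_derivative 0) (at (w $ k))
      \<longleftrightarrow> (\<Sum>c<n. G_bar n A $$ (k, c) * w $ c) + l = 0" if "k < n" for k
    using wls_lagrangian_partial_derivative[OF diag w that, of l] DERIV_unique by fastforce
  moreover have "((\<lambda>\<mu>. wls_lagrangian n A w \<mu>) has_real_derivative ((\<Sum>i<n. w $ i) - 1)) (at (2 * l))"
    unfolding wls_lagrangian_def by (auto intro!: derivative_eq_intros)
  then have "((\<lambda>\<mu>. wls_lagrangian n A w \<mu>) has_real_derivative 0) (at (2 * l))
      \<longleftrightarrow> (\<Sum>i<n. w $ i) = 1"
    using DERIV_unique by fastforce
  ultimately show "(\<forall>k<n. ((\<lambda>t. wls_lagrangian n A (w |\<^sub>v k \<mapsto> t) (2 * l))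
                  has_real_derivative 0) (at (w $ k))) \<and>
       ((\<lambda>\<mu>. wls_lagrangian n A w \<mu>) has_real_derivative 0) (at (2 * l))
       \<longleftrightarrow> lagrange_system n A w l"
    unfolding lagrange_system_iff by simp
next
  fix w :: "real vec" and l :: real assume "w \<in> carrier_vec n"
  then show "lagrange_system n A w l
       \<longleftrightarrow> G_ddot n A * transpose_mat (w_ddot w l) = transpose_mat (q_ddot n)"
    by (rule lagrange_system_iff_G_ddot)
next
  show "transpose_mat (G_ddot n A) = G_ddot n A"
    by (rule G_ddot_symmetric)
next
  show "gram_matrix (G_bar n A)"
    by (rule G_bar_gram) (rule pairwise_reciprocal_diag[OF assms(2)])
next
  let ?G = "G_ddot n A"
  note G = G_ddot_carrier[of n A]
  from det_non_zero_imp_unit[OF G det_G_ddot_nonzero[OF assms]]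
  obtain H where H: "H \<in> carrier_mat (n + 1) (n + 1)"
    and HG: "H * ?G = 1\<^sub>m (n + 1)" and GH: "?G * H = 1\<^sub>m (n + 1)"
    unfolding Units_def ring_mat_def by auto
  have "?G * transpose_mat (w_ddot w l) = transpose_mat (q_ddot n) \<longleftrightarrow> w_ddot w l = q_ddot n * H"
    if "w \<in> carrier_vec n" for w l
  proof -
    have W: "w_ddot w l \<in> carrier_mat 1 (n + 1)" and Q: "q_ddot n \<in> carrier_mat 1 (n + 1)"
      using that by (simp_all add: w_ddot_def q_ddot_def mat_of_row_def)
    \<comment> \<open>Symmetry of \<open>?G\<close> moves the system to row vectors, where
      \<open>H\<close> can be multiplied on the right.\<close>
    have "?G * transpose_mat (w_ddot w l) = transpose_mat (w_ddot w l * ?G)"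
      using transpose_mult[OF W G] by (simp add: G_ddot_symmetric)
    then have "?G * transpose_mat (w_ddot w l) = transpose_mat (q_ddot n)
        \<longleftrightarrow> w_ddot w l * ?G = q_ddot n"
      by simp
    also have "\<dots> \<longleftrightarrow> w_ddot w l = q_ddot n * H"
    proof
      assume "w_ddot w l * ?G = q_ddot n"
      then have "q_ddot n * H = w_ddot w l * (?G * H)"
        using assoc_mult_mat[OF W G H] by simp
      then show "w_ddot w l = q_ddot n * H"
        using W by (simp add: GH)
    next
      assume "w_ddot w l = q_ddot n * H"
      then have "w_ddot w l * ?G = q_ddot n * (H * ?G)"
        using assoc_mult_mat[OF Q H G] by simp
      then show "w_ddot w l * ?G = q_ddot n"
        using Q by (simp add: HG)
    qed
    finally show ?thesis .
  qed
  then show "\<exists>H \<in> carrier_mat (n + 1) (n + 1).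
       inverts_mat ?G H \<and> inverts_mat H ?G \<and>
       (\<forall>w \<in> carrier_vec n. \<forall>l.
          ?G * transpose_mat (w_ddot w l) = transpose_mat (q_ddot n)
          \<longleftrightarrow> w_ddot w l = q_ddot n * H)"
    using H G HG GH by (intro bexI[of _ H]) (auto simp: inverts_mat_def)
qed

end
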